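(* Let $r\ge1$, let $\mathbf p_{L_r}(\theta)=\hat a_0+\hat a_{-1}e^{-\iota\theta}+\hat a_1e^{\iota\theta}$ be the $r\times r$ matrix-valued trigonometric polynomial (associated with scalar linear interpolation) with coefficients $\hat a_0,\hat a_{-1},\hat a_1$ given in the context, and let $\mathrm e_r=[1,\dots,1]^T\in\mathbb R^r$. Then: 1) $\mathbf p_{L_r}(0)\,\mathrm e_r=4\,\mathrm e_r$; 2) $\mathbf p_{L_r}(\pi)\,\mathrm e_r=0\,\mathrm e_r$; 3) $\mathbf p_{L_r}(0)^H\,\mathrm e_r=4\,\mathrm e_r$.
   Context: $\iota^2=-1$; $X^H$ is the conjugate transpose. The coefficients are as follows. In all cases $\hat a_1$ is the $r\times r$ matrix whose only nonzero entry is a $1$ in position $(1,r)$. Even $r$: let $A_1\in\mathbb R^{r\times r/2}$ be the matrix whose $j$-th column ($j=1,\dots,r/2$) has entries $1,2,1$ in rows $2j-1,2j,2j+1$ respectively (the entry in row $r+1$ being dropped for $j=r/2$) and zeros elsewhere. Then $\hat a_{-1}=[\,A_1\mid \mathbf 0_{r,r/2}\,]$ and $\hat a_0=[\,\mathbf 0_{r,\frac r2-1}\mid \varepsilon_1\mid A_1\,]$, where $\varepsilon_1=[1,0,\dots,0]^T\in\mathbb R^r$. Odd $r$: let $A_2\in\mathbb R^{r\times\frac{r+1}2}$ be the matrix whose $j$-th column ($j=1,\dots,\frac{r+1}2$) has entries $1,2,1$ in rows $2j-2,2j-1,2j$ respectively, and $A_3\in\mathbb R^{r\times\frac{r+1}2}$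 the matrix whose $j$-th column has entries $1,2,1$ in rows $2j-1,2j,2j+1$ respectively; in both cases entries falling outside rows $1,\dots,r$ are dropped and all other entries are zero. Then $\hat a_{-1}=[\,A_3\mid\mathbf 0_{r,\frac{r-1}2}\,]$ and $\hat a_0=[\,\mathbf 0_{r,\frac{r-1}2}\mid A_2\,]$. Here $\mathbf 0_{a,b}$ is the $a\times b$ zero matrix. *)

theory Defs
  imports Complex_Main "Jordan_Normal_Form.Matrix" "Jordan_Normal_Form.Schur_Decomposition"
begin

definition append_cols :: "'a :: zero mat \<Rightarrow> 'a mat \<Rightarrow> 'a mat" (infixr "@\<^sub>c" 65) where
  "A @\<^sub>c B = four_block_mat A B (0\<^sub>m 0 (dim_col A)) (0\<^sub>m 0 (dim_col B))"

lemma carrier_append_cols [simp, intro]: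
  "A \<in> carrier_mat nr nc1 \<Longrightarrow> B \<in> carrier_mat nr nc2 \<Longrightarrow> A @\<^sub>c B \<in> carrier_mat nr (nc1 + nc2)"
  unfolding append_cols_def by auto

text \<open>The $r \times m$ matrix whose $j$-th column has entries 1, 2, 1 in the rows
  $c(j)-1$, $c(j)$, $c(j)+1$; entries falling outside rows $1,\dots,r$ are dropped. Rows, columns
  and the centre $c(j)$ are counted from 1, whereas the indices of \<^const>\<open>mat\<close> start at 0.\<close>

definition stencil_mat :: "nat \<Rightarrow> nat \<Rightarrow> (nat \<Rightarrow> nat) \<Rightarrow> real mat" where
  "stencil_mat r m c = mat r m (\<lambda>(i, j).
     if Suc i = c (Suc j) then 2
     else if Suc i + 1 = c (Suc j) \<or> Suc i = c (Suc j) + 1 then 1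
     else 0)"

definition A1 :: "nat \<Rightarrow> real mat" where
  "A1 r = stencil_mat r (r div 2) (\<lambda>j. 2 * j)"

definition A2 :: "nat \<Rightarrow> real mat" where
  "A2 r = stencil_mat r ((r + 1) div 2) (\<lambda>j. 2 * j - 1)"

definition A3 :: "nat \<Rightarrow> real mat" where
  "A3 r = stencil_mat r ((r + 1) div 2) (\<lambda>j. 2 * j)"

definition a_minus1 :: "nat \<Rightarrow> real mat" where
  "a_minus1 r = (if even r then A1 r @\<^sub>c 0\<^sub>m r (r div 2)
                 else A3 r @\<^sub>c 0\<^sub>m r ((r - 1) div 2))"

definition a_zero :: "nat \<Rightarrow> real mat" where
  "a_zero r = (if even r then 0\<^sub>m r (r div 2 - 1) @\<^sub>c mat_of_cols r [unit_vec r 0] @\<^sub>c A1 r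
               else 0\<^sub>m r ((r - 1) div 2) @\<^sub>c A2 r)"

definition a_plus1 :: "nat \<Rightarrow> real mat" where
  "a_plus1 r = mat r r (\<lambda>(i, j). if i = 0 \<and> j = r - 1 then 1 else 0)"

definition p_L :: "nat \<Rightarrow> real \<Rightarrow> complex mat" where
  "p_L r \<theta> = map_mat complex_of_real (a_zero r)
     + exp (- (\<i> * complex_of_real \<theta>)) \<cdot>\<^sub>m map_mat complex_of_real (a_minus1 r)
     + exp (\<i> * complex_of_real \<theta>) \<cdot>\<^sub>m map_mat complex_of_real (a_plus1 r)"

definition ones_vec :: "nat \<Rightarrow> complex vec" where
  "ones_vec r = vec r (\<lambda>_. 1)"

lemma stencil_mat_carrier [simp]: "stencil_mat r m c \<in> carrier_mat r m"
  by (simp add: stencil_mat_def)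

lemma a_minus1_carrier: "a_minus1 r \<in> carrier_mat r r"
proof (cases "even r")
  case True
  have "A1 r @\<^sub>c 0\<^sub>m r (r div 2) \<in> carrier_mat r (r div 2 + r div 2)"
    unfolding A1_def by (intro carrier_append_cols stencil_mat_carrier zero_carrier_mat)
  moreover have "r div 2 + r div 2 = r"
    using True by presburger
  ultimately show ?thesis unfolding a_minus1_def if_P[OF True] by (rule back_subst[where P = "\<lambda>n. _ \<in> carrier_mat r n"])
next
  case False
  have "A3 r @\<^sub>c 0\<^sub>m r ((r - 1) div 2) \<in> carrier_mat r ((r + 1) div 2 + (r - 1) div 2)"
    unfolding A3_def by (intro carrier_append_cols stencil_mat_carrier zero_carrier_mat)
  moreover have "(r + 1) div 2 + (r - 1) div 2 = r"
    using False by presburger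
  ultimately show ?thesis unfolding a_minus1_def if_not_P[OF False] by (rule back_subst[where P = "\<lambda>n. _ \<in> carrier_mat r n"])
qed

lemma a_zero_carrier:
  assumes "r \<ge> 1"
  shows "a_zero r \<in> carrier_mat r r"
proof (cases "even r")
  case True
  have "mat_of_cols r [unit_vec r 0 :: real vec] \<in> carrier_mat r 1"
    using mat_of_cols_carrier(1)[of r "[unit_vec r 0 :: real vec]"] by simp
  then have "0\<^sub>m r (r div 2 - 1) @\<^sub>c mat_of_cols r [unit_vec r 0] @\<^sub>c A1 r
      \<in> carrier_mat r ((r div 2 - 1) + (1 + r div 2))"
    unfolding A1_def by (intro carrier_append_cols stencil_mat_carrier zero_carrier_mat)
  moreover have "(r div 2 - 1) + (1 + r div 2) = r"
    using True assms by presburger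
  ultimately show ?thesis unfolding a_zero_def if_P[OF True] by (rule back_subst[where P = "\<lambda>n. _ \<in> carrier_mat r n"])
next
  case False
  have "0\<^sub>m r ((r - 1) div 2) @\<^sub>c A2 r \<in> carrier_mat r ((r - 1) div 2 + (r + 1) div 2)"
    unfolding A2_def by (intro carrier_append_cols stencil_mat_carrier zero_carrier_mat)
  moreover have "(r - 1) div 2 + (r + 1) div 2 = r"
    using False by presburger
  ultimately show ?thesis unfolding a_zero_def if_not_P[OF False] by (rule back_subst[where P = "\<lambda>n. _ \<in> carrier_mat r n"])
qed

lemma a_plus1_carrier: "a_plus1 r \<in> carrier_mat r r"
  by (simp add: a_plus1_def)

lemma p_L_carrier: "p_L r \<theta> \<in> carrier_mat r r"
  unfolding p_L_def by (intro add_carrier_mat smult_carrier_mat map_carrier_mat[THEN iffD2] a_plus1_carrier)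

end

theory Submission
  imports Defs
begin

text \<open>Each column of \<open>A\<^sub>1\<close>, \<open>A\<^sub>2\<close>, \<open>A\<^sub>3\<close> that is not truncated sums to 4, and consecutive stencils
  overlap so that each row sums to 2, up to boundary effects. The vector \<open>\<epsilon>\<^sub>1\<close> and the single
  entry of \<open>a_plus1\<close> compensate these effects: all row sums of
  \<open>a_zero\<close> and of \<open>a_minus1 + a_plus1\<close> equal 2, so they add up at 0 and cancel at \<open>\<pi>\<close>, while all column
  sums of the total equal 4.\<close>

definition row_sum :: "'a :: comm_monoid_add mat \<Rightarrow> nat \<Rightarrow> 'a" where
  "row_sum A i = (\<Sum>j<dim_col A. A $$ (i, j))"

definition col_sum :: "'a :: comm_monoid_add mat \<Rightarrow> nat \<Rightarrow> 'a" where
  "col_sum A j = (\<Sum>i<dim_row A. A $$ (i, j))"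

lemma index_append_cols:
  assumes "A \<in> carrier_mat n a" "B \<in> carrier_mat n b" "i < n" "j < a + b"
  shows "(A @\<^sub>c B) $$ (i, j) = (if j < a then A $$ (i, j) else B $$ (i, j - a))"
  using assms by (simp add: append_cols_def)

lemma row_sum_append_cols:
  assumes A: "A \<in> carrier_mat n a" and B: "B \<in> carrier_mat n b" and i: "i < n"
  shows "row_sum (A @\<^sub>c B) i = row_sum A i + row_sum B i"
proof -
  have "row_sum (A @\<^sub>c B) i = (\<Sum>j<a + b. if j < a then A $$ (i, j) else B $$ (i, j - a))"
    unfolding row_sum_def
    using index_append_cols[OF A B i] carrier_append_cols[OF A B] by (auto intro!: sum.cong)
  also have "\<dots> = (\<Sum>j<a. A $$ (i, j)) + (\<Sum>j<b. B $$ (i, j))"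
    by (induction b) (simp_all add: add.assoc)
  finally show ?thesis
    using A B by (simp add: row_sum_def)
qed

lemma col_sum_append_cols:
  assumes A: "A \<in> carrier_mat n a" and B: "B \<in> carrier_mat n b" and j: "j < a + b"
  shows "col_sum (A @\<^sub>c B) j = (if j < a then col_sum A j else col_sum B (j - a))"
proof -
  have "dim_row (A @\<^sub>c B) = n"
    using carrier_append_cols[OF A B] by (rule carrier_matD)
  then show ?thesis
    using A B index_append_cols[OF A B _ j] by (simp add: col_sum_def)
qed

lemma row_sum_zero_mat: "i < n \<Longrightarrow> row_sum (0\<^sub>m n m) i = 0"
  by (simp add: row_sum_def)

lemma col_sum_zero_mat: "j < m \<Longrightarrow> col_sum (0\<^sub>m n m) j = 0"
  by (simp add: col_sum_def)

lemma unit_column_carrier: "mat_of_cols r [unit_vec r k] \<in> carrier_mat r 1"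
  using mat_of_cols_carrier(1)[of r "[unit_vec r k]"] by simp

lemma row_sum_unit_column:
  "i < r \<Longrightarrow> row_sum (mat_of_cols r [unit_vec r k]) i = (if i = k then 1 else 0)"
  by (simp add: row_sum_def mat_of_cols_def unit_vec_def)

lemma col_sum_unit_column:
  assumes "k < r"
  shows "col_sum (mat_of_cols r [unit_vec r k]) 0 = 1"
  using assms by (simp add: col_sum_def mat_of_cols_def unit_vec_def)

text \<open>Counting from 0, column \<open>j\<close> is centred at row \<open>2 * j + 1\<close>. An
  odd row holds one centre; an even row collects a 1 from each of two neighbouring columns, except
  that rows 0 and \<open>2 * m\<close> border only one. Adding a column shifts the bottom boundary
  by two rows, hence the induction on \<open>m\<close>.\<close>

lemma row_sum_stencil_even:
  assumes "i < r"
  shows "row_sum (stencil_mat r m (\<lambda>j. 2 * j)) i =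
    (if i < 2 * m then if i = 0 then 1 else 2 else if i = 2 * m \<and> 0 < m then 1 else 0)"
  (is "_ = ?rhs")
proof -
  have "row_sum (stencil_mat r m (\<lambda>j. 2 * j)) i =
      (\<Sum>j<m. if i = 2 * j + 1 then 2 else if i = 2 * j \<or> i = 2 * j + 2 then 1 else 0)"
    using assms by (auto simp: row_sum_def stencil_mat_def intro!: sum.cong)
  also have "\<dots> = ?rhs"
    by (induction m) auto
  finally show ?thesis .
qed

text \<open>The values 0, 1, 3, 4 are the partial sums of 1, 2, 1, cut off by the number
  \<open>r\<close> of rows.\<close>

lemma col_sum_stencil_even:
  assumes "j < m"
  shows "col_sum (stencil_mat r m (\<lambda>j. 2 * j)) j =
    (if r \<le> 2 * j then 0 else if r = 2 * j + 1 then 1 else if r = 2 * j + 2 then 3 else 4)"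
  (is "_ = ?rhs")
proof -
  have "col_sum (stencil_mat r m (\<lambda>j. 2 * j)) j =
      (\<Sum>i<r. if i = 2 * j + 1 then 2 else if i = 2 * j \<or> i = 2 * j + 2 then 1 else 0)"
    using assms by (auto simp: col_sum_def stencil_mat_def intro!: sum.cong)
  also have "\<dots> = ?rhs"
    by (induction r) auto
  finally show ?thesis .
qed

text \<open>Here the centres sit in the even rows \<open>2 * j\<close>, so row 0 already carries a
  full 2 and only the bottom row \<open>2 * m - 1\<close> is deficient.\<close>

lemma row_sum_stencil_odd:
  assumes "i < r"
  shows "row_sum (stencil_mat r m (\<lambda>j. 2 * j - 1)) i =
    (if i + 1 < 2 * m then 2 else if i + 1 = 2 * m then 1 else 0)"
  (is "_ = ?rhs")
proof -
  have "row_sum (stencil_mat r m (\<lambda>j. 2 * j - 1)) i =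
      (\<Sum>j<m. if i = 2 * j then 2 else if i + 1 = 2 * j \<or> i = 2 * j + 1 then 1 else 0)"
    using assms by (auto simp: row_sum_def stencil_mat_def intro!: sum.cong)
  also have "\<dots> = ?rhs"
    by (induction m) auto
  finally show ?thesis .
qed

text \<open>Again partial sums of 1, 2, 1, but column 0 loses its upper 1, which lowers its values
  by one.\<close>

lemma col_sum_stencil_odd:
  assumes "j < m"
  shows "col_sum (stencil_mat r m (\<lambda>j. 2 * j - 1)) j =
    (if r < 2 * j then 0 else if r = 2 * j then if j = 0 then 0 else 1
     else if r = 2 * j + 1 then if j = 0 then 2 else 3 else if j = 0 then 3 else 4)"
  (is "_ = ?rhs")
proof -
  have "col_sum (stencil_mat r m (\<lambda>j. 2 * j - 1)) j =
      (\<Sum>i<r. if i = 2 * j then 2 else if i + 1 = 2 * j \<or> i = 2 * j + 1 then 1 else 0)"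
    using assms by (auto simp: col_sum_def stencil_mat_def intro!: sum.cong)
  also have "\<dots> = ?rhs"
    by (induction r) auto
  finally show ?thesis .
qed

lemma row_sum_a_plus1:
  assumes "i < r"
  shows "row_sum (a_plus1 r) i = (if i = 0 then 1 else 0)"
  using assms by (simp add: row_sum_def a_plus1_def sum.delta)

lemma col_sum_a_plus1:
  assumes "j < r"
  shows "col_sum (a_plus1 r) j = (if j = r - 1 then 1 else 0)"
  using assms by (simp add: col_sum_def a_plus1_def sum.delta)

text \<open>The stencil block has \<open>m\<close> columns with \<open>r \<le> 2 * m\<close>, so its
  bottom boundary is never reached. Only row 0 is deficient, and the entry of \<open>a_plus1\<close>
  later fills that gap.\<close>

lemma row_sum_a_minus1:
  assumes i: "i < r"
  shows "row_sum (a_minus1 r) i = (if i = 0 then 1 else 2)"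
proof (cases "even r")
  case True
  with i show ?thesis
    by (auto simp: a_minus1_def A1_def row_sum_append_cols[OF stencil_mat_carrier zero_carrier_mat i]
        row_sum_zero_mat row_sum_stencil_even)
next
  case False
  with i show ?thesis
    by (auto simp: a_minus1_def A3_def row_sum_append_cols[OF stencil_mat_carrier zero_carrier_mat i]
        row_sum_zero_mat row_sum_stencil_even)
qed

lemma row_sum_a_zero:
  assumes i: "i < r"
  shows "row_sum (a_zero r) i = 2"
proof (cases "even r")
  case True
  \<comment> \<open>Concatenation associates to the right, so the unit column and \<open>A1\<close>
    form the inner block. The unit column supplies the 1 that \<open>A1\<close> lacks in row
    0.\<close>
  note inner = carrier_append_cols[OF unit_column_carrier stencil_mat_carrier]
  show ?thesis using True i
    by (auto simp: a_zero_def A1_def row_sum_append_cols[OF zero_carrier_mat inner i]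
        row_sum_append_cols[OF unit_column_carrier stencil_mat_carrier i]
        row_sum_zero_mat row_sum_stencil_even row_sum_unit_column)
next
  case False
  \<comment> \<open>For odd \<open>r\<close> the right side is \<open>r + 1\<close>, so the
    deficient row of \<open>A2\<close> lies just outside the matrix.\<close>
  with i have "i + 1 < 2 * ((r + 1) div 2)"
    by presburger
  with False i show ?thesis
    by (simp add: a_zero_def A2_def row_sum_append_cols[OF zero_carrier_mat stencil_mat_carrier i]
        row_sum_zero_mat row_sum_stencil_odd del: One_nat_def)
qed

lemma col_sum_a_total:
  assumes j: "j < r"
  shows "col_sum (a_zero r) j + col_sum (a_minus1 r) j + col_sum (a_plus1 r) j = 4"
proof (cases "even r")
  case True
  \<comment> \<open>Since \<open>r\<close> is even and positive, this form turns
    \<open>r div 2 - 1\<close> into \<open>k\<close>.\<close>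
  with j obtain k where r: "r = 2 * k + 2"
    by (metis evenE gr_implies_not_zero mult_0_right mult_Suc_right not0_implies_Suc add.commute)
  note inner = carrier_append_cols[OF unit_column_carrier stencil_mat_carrier]
  \<comment> \<open>The two blocks meet at column \<open>k\<close>: the unit column gives 1 there,
    against the 3 of the truncated last column of \<open>A1\<close> in \<open>a_minus1\<close>. The
    same truncation in column \<open>r - 1\<close> is repaired by \<open>a_plus1\<close>.\<close>
  have zero: "col_sum (a_zero r) j =
      (if j < k then 0 else if j = k then 1 else if j = r - 1 then 3 else 4)"
    using j r
    by (auto simp: a_zero_def A1_def col_sum_append_cols[OF zero_carrier_mat inner]
        col_sum_append_cols[OF unit_column_carrier stencil_mat_carrier]
        col_sum_zero_mat col_sum_stencil_even col_sum_unit_column)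
  have minus: "col_sum (a_minus1 r) j = (if j < k then 4 else if j = k then 3 else 0)"
    using j r
    by (auto simp: a_minus1_def A1_def col_sum_append_cols[OF stencil_mat_carrier zero_carrier_mat]
        col_sum_zero_mat col_sum_stencil_even)
  show ?thesis
    unfolding zero minus col_sum_a_plus1[OF j] using j r by auto
next
  case False
  then obtain k where r: "r = 2 * k + 1" using oddE by blast
  \<comment> \<open>For \<open>k = 0\<close> the only column is cut at both ends, leaving just its
    centre 2. Otherwise the first and last columns of \<open>A2\<close> each lose a single
    1.\<close>
  have zero: "col_sum (a_zero r) j =
      (if j < k then 0 else if k = 0 then 2 else if j = k \<or> j = r - 1 then 3 else 4)"
    using j r
    by (auto simp: a_zero_def A2_def col_sum_append_cols[OF zero_carrier_mat stencil_mat_carrier]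
        col_sum_zero_mat col_sum_stencil_odd simp del: One_nat_def)
  have minus: "col_sum (a_minus1 r) j = (if j < k then 4 else if j = k then 1 else 0)"
    using j r
    by (auto simp: a_minus1_def A3_def col_sum_append_cols[OF stencil_mat_carrier zero_carrier_mat]
        col_sum_zero_mat col_sum_stencil_even)
  show ?thesis
    unfolding zero minus col_sum_a_plus1[OF j] using j r by auto
qed

lemma index_smult_ones: "i < r \<Longrightarrow> (c \<cdot>\<^sub>v ones_vec r) $ i = c"
  by (simp add: ones_vec_def)

lemma index_p_L:
  assumes "i < r" "j < r"
  shows "p_L r \<theta> $$ (i, j) = complex_of_real (a_zero r $$ (i, j))
    + exp (- (\<i> * complex_of_real \<theta>)) * complex_of_real (a_minus1 r $$ (i, j))
    + exp (\<i> * complex_of_real \<theta>) * complex_of_real (a_plus1 r $$ (i, j))"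
  using assms a_zero_carrier[of r] a_minus1_carrier[of r] a_plus1_carrier[of r]
  by (simp add: p_L_def)

text \<open>Row sums are linear in the matrix, so all dependence on \<theta> sits in two scalar
  factors on real row sums.\<close>

lemma p_L_mult_ones:
  assumes i: "i < r"
  shows "(p_L r \<theta> *\<^sub>v ones_vec r) $ i = complex_of_real (row_sum (a_zero r) i)
    + exp (- (\<i> * complex_of_real \<theta>)) * complex_of_real (row_sum (a_minus1 r) i)
    + exp (\<i> * complex_of_real \<theta>) * complex_of_real (row_sum (a_plus1 r) i)"
proof -
  have "(p_L r \<theta> *\<^sub>v ones_vec r) $ i = (\<Sum>j<r. p_L r \<theta> $$ (i, j))"
    using i p_L_carrier[of r \<theta>] by (simp add: scalar_prod_def ones_vec_def atLeast0LessThan)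
  then show ?thesis
    using i a_zero_carrier[of r] a_minus1_carrier[of r] a_plus1_carrier[of r]
    by (simp add: index_p_L row_sum_def sum.distrib sum_distrib_left)
qed

text \<open>At angle 0 both exponentials are 1 and the coefficients are real, so conjugation has no
  effect and transposition turns row sums into column sums.\<close>

lemma adjoint_p_L_mult_ones:
  assumes j: "j < r"
  shows "(mat_adjoint (p_L r 0) *\<^sub>v ones_vec r) $ j =
    complex_of_real (col_sum (a_zero r) j + col_sum (a_minus1 r) j + col_sum (a_plus1 r) j)"
proof -
  have "(mat_adjoint (p_L r 0) *\<^sub>v ones_vec r) $ j = (\<Sum>i<r. cnj (p_L r 0 $$ (i, j)))"
    using j p_L_carrier[of r 0]
    by (simp add: mat_adjoint_def scalar_prod_def ones_vec_def atLeast0LessThan)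
  then show ?thesis
    using j a_zero_carrier[of r] a_minus1_carrier[of r] a_plus1_carrier[of r]
    by (simp add: index_p_L col_sum_def sum.distrib)
qed

theorem lemma5p2:
  fixes r :: nat
  assumes "r \<ge> 1"
  shows "p_L r 0 *\<^sub>v ones_vec r = 4 \<cdot>\<^sub>v ones_vec r
    \<and> p_L r pi *\<^sub>v ones_vec r = 0 \<cdot>\<^sub>v ones_vec r
    \<and> mat_adjoint (p_L r 0) *\<^sub>v ones_vec r = 4 \<cdot>\<^sub>v ones_vec r"
proof (intro conjI eq_vecI)
  fix i
  assume "i < dim_vec (4 \<cdot>\<^sub>v ones_vec r)"
  then have i: "i < r" by (simp add: ones_vec_def)
  show "(p_L r 0 *\<^sub>v ones_vec r) $ i = (4 \<cdot>\<^sub>v ones_vec r) $ i"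
    using i by (simp add: p_L_mult_ones[OF i] row_sum_a_zero row_sum_a_minus1 row_sum_a_plus1
        index_smult_ones del: index_mult_mat_vec index_smult_vec)
  show "(mat_adjoint (p_L r 0) *\<^sub>v ones_vec r) $ i = (4 \<cdot>\<^sub>v ones_vec r) $ i"
    using i by (simp only: adjoint_p_L_mult_ones col_sum_a_total index_smult_ones) simp
next
  fix i
  assume "i < dim_vec (0 \<cdot>\<^sub>v ones_vec r)"
  then have i: "i < r" by (simp add: ones_vec_def)
  \<comment> \<open>Both exponentials are -1 at \<pi>, giving 2 - 1 - 1 in row 0 and 2 - 2 - 0 in
    the other rows.\<close>
  show "(p_L r pi *\<^sub>v ones_vec r) $ i = (0 \<cdot>\<^sub>v ones_vec r) $ i"
    using i by (simp add: p_L_mult_ones[OF i] row_sum_a_zero row_sum_a_minus1 row_sum_a_plus1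
        index_smult_ones exp_minus del: index_mult_mat_vec index_smult_vec)
qed (use p_L_carrier[of r] in \<open>auto simp: ones_vec_def mat_adjoint_def\<close>)

end
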